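(* Let $n\geq 1$ be an integer and let $\mathbb{CL}(n)$ be the Clifford group of degree $n$. Then: (i) $(\mathbb{CL}(n)\times \mathbb{CL}(n)\times \mathbb{CL}(n), \widetilde{\mathbb{CL}(n)})$ is a Gelfand pair; (ii) $(\mathbb{CL}(n)\times \mathbb{CL}(n)\times \mathbb{CL}(n-1), \widetilde{\mathbb{CL}(n-1)})$ is a Gelfand pair if and only if $n$ is odd.
   Context: For $n\geq 0$ let $X_n=\{1,2,\ldots,n\}$ (so $X_0=\varnothing$). The Clifford group of degree $n$ is the group $\mathbb{CL}(n)=\{\pm\gamma_A : A\subseteq X_n\}$ of order $2^{n+1}$ (the elements $\varepsilon\gamma_A$, $\varepsilon=\pm1$, $A\subseteq X_n$, being pairwise distinct formal symbols), with multiplication $\varepsilon_1\gamma_A\cdot\varepsilon_2\gamma_B=\varepsilon_1\varepsilon_2(-1)^{\xi(A,B)}\gamma_{A\triangle B}$, where $A\triangle B$ is the symmetric difference and $\xi(A,B)$ is the number of pairs $(a,b)\in A\times B$ with $a>b$. The identity is $\gamma_\varnothing$. For $n\geq 1$, $\mathbb{CL}(n-1)$ is regarded as the subgroup $\{\pm\gamma_A : A\subseteq X_{n-1}\}$ of $\mathbb{CL}(n)$. For a finite group $G$ and a subgroup $H\leq G$, $\widetilde H=\{(h,h,h):h\in H\}\leq G\times G\times H$. For a finite group $\Gamma$ and a subgroup $K\leq \Gamma$, $L(\Gamma)$ is the algebra of all functions $f\colon\Gamma\to\mathbb{C}$ with the convolution product $[f_1*f_2](g)=\sum_{h\in \Gamma}f_1(h)f_2(h^{-1}g)$.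 The pair $(\Gamma,K)$ is a Gelfand pair if the subalgebra $\{f\in L(\Gamma): f(k_1gk_2)=f(g)\ \forall g\in \Gamma,\ \forall k_1,k_2\in K\}$ of bi-$K$-invariant functions is commutative. *)

theory Defs
  imports Complex_Main "HOL-Algebra.Group"
begin

section \<open>Clifford groups\<close>

definition inversions :: "nat set \<Rightarrow> nat set \<Rightarrow> nat" where
  "inversions A B = card {(a, b) \<in> A \<times> B. a > b}"

text \<open>The formal symbol \<open>\<epsilon> \<gamma>\<^sub>A\<close> is encoded as the pair \<open>(\<epsilon>, A)\<close> with \<open>\<epsilon> \<in> {1, -1}\<close>.\<close>

definition clifford_group :: "nat \<Rightarrow> (int \<times> nat set) monoid" where
  "clifford_group n =
    \<lparr>carrier = {1, -1} \<times> Pow {1..n},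
     monoid.mult = (\<lambda>(e1, A) (e2, B). (e1 * e2 * (-1) ^ inversions A B, (A - B) \<union> (B - A))),
     one = (1, {})\<rparr>"

section \<open>Gelfand pairs\<close>

text \<open>The functions on the group \<open>G\<close> are represented by the functions that are \<open>undefined\<close>
  outside \<open>carrier G\<close>, so that they are determined by their values on the carrier.\<close>

definition convolution :: "('a, 'm) monoid_scheme \<Rightarrow> ('a \<Rightarrow> complex) \<Rightarrow> ('a \<Rightarrow> complex) \<Rightarrow> 'a \<Rightarrow> complex" where
  "convolution G f1 f2 = (\<lambda>g\<in>carrier G. \<Sum>h\<in>carrier G. f1 h * f2 (inv\<^bsub>G\<^esub> h \<otimes>\<^bsub>G\<^esub> g))"

definition bi_invariant :: "('a, 'm) monoid_scheme \<Rightarrow> 'a set \<Rightarrow> ('a \<Rightarrow> complex) set" where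
  "bi_invariant G K =
    {f \<in> carrier G \<rightarrow>\<^sub>E UNIV. \<forall>g\<in>carrier G. \<forall>k1\<in>K. \<forall>k2\<in>K. f (k1 \<otimes>\<^bsub>G\<^esub> g \<otimes>\<^bsub>G\<^esub> k2) = f g}"

text \<open>This is meant for a finite group \<open>G\<close> and a subgroup \<open>K\<close> only; these conditions are not part
  of the definition. For the pairs built from Clifford groups they hold by
  \<open>clifford_triple_group\<close>, \<open>clifford_triple_finite\<close> and \<open>clifford_diag3_subgroup\<close> below.\<close>

definition gelfand_pair :: "('a, 'm) monoid_scheme \<Rightarrow> 'a set \<Rightarrow> bool" where
  "gelfand_pair G K \<longleftrightarrow>
    (\<forall>f1\<in>bi_invariant G K. \<forall>f2\<in>bi_invariant G K. convolution G f1 f2 = convolution G f2 f1)"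

definition diag3 :: "'a set \<Rightarrow> ('a \<times> 'a \<times> 'a) set" where
  "diag3 H = {(h, h, h) | h. h \<in> H}"

section \<open>Well-definedness\<close>

lemma sign_inversions:
  assumes "finite A" "finite B"
  shows "(-1 :: int) ^ inversions A B = (\<Prod>a\<in>A. \<Prod>b\<in>B. if a > b then -1 else 1)"
proof -
  have "(\<Prod>a\<in>A. \<Prod>b\<in>B. if a > b then -1 else (1::int))
      = (\<Prod>p\<in>A \<times> B. if p \<in> {(a, b). a > b} then -1 else 1)"
    by (simp add: prod.cartesian_product case_prod_beta)
  also have "\<dots> = (\<Prod>p\<in>(A \<times> B) \<inter> {(a, b). a > b}. -1)"
    using assms by (subst prod.inter_restrict) auto
  also have "\<dots> = (-1) ^ inversions A B"
    unfolding inversions_def by (simp, rule arg_cong[where f = "\<lambda>S. (-1) ^ card S"]) auto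
  finally show ?thesis by simp
qed

lemma prod_sym_diff:
  fixes f :: "'a \<Rightarrow> int"
  assumes "finite A" "finite B" "\<And>x. f x * f x = 1"
  shows "prod f ((A - B) \<union> (B - A)) = prod f A * prod f B"
proof -
  have sq: "prod f (A \<inter> B) * prod f (A \<inter> B) = 1"
    using assms(3) by (simp flip: prod.distrib)
  have a: "prod f A = prod f (A \<inter> B) * prod f (A - B)"
    using assms by (metis Diff_Int2 prod.Int_Diff)
  have b: "prod f B = prod f (A \<inter> B) * prod f (B - A)"
    using assms by (metis Int_commute prod.Int_Diff)
  have c: "prod f ((A - B) \<union> (B - A)) = prod f (A - B) * prod f (B - A)"
    using assms by (intro prod.union_disjoint) auto
  have "prod f A * prod f B = (prod f (A \<inter> B) * prod f (A \<inter> B)) * (prod f (A - B) * prod f (B - A))"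
    unfolding a b by (simp add: ac_simps)
  then show ?thesis by (simp add: sq c)
qed

lemma sign_inversions_sym_diff_left:
  assumes "finite A" "finite B" "finite C"
  shows "(-1 :: int) ^ inversions ((A - B) \<union> (B - A)) C
    = (-1) ^ inversions A C * (-1) ^ inversions B C"
proof -
  let ?f = "\<lambda>a. \<Prod>b\<in>C. if a > b then -1 else (1::int)"
  have "?f a * ?f a = 1" for a
    unfolding prod.distrib[symmetric] by (rule prod.neutral) simp
  then have "prod ?f ((A - B) \<union> (B - A)) = prod ?f A * prod ?f B"
    using assms by (intro prod_sym_diff)
  then show ?thesis using assms by (simp add: sign_inversions)
qed

lemma sign_inversions_sym_diff_right:
  assumes "finite A" "finite B" "finite C"
  shows "(-1 :: int) ^ inversions A ((B - C) \<union> (C - B))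
    = (-1) ^ inversions A B * (-1) ^ inversions A C"
  using assms by (simp add: sign_inversions prod_sym_diff flip: prod.distrib)

lemma clifford_group_is_group: "group (clifford_group n)"
proof (rule groupI)
  fix x y assume "x \<in> carrier (clifford_group n)" "y \<in> carrier (clifford_group n)"
  then show "x \<otimes>\<^bsub>clifford_group n\<^esub> y \<in> carrier (clifford_group n)"
    by (cases x; cases y; cases "even (inversions (snd x) (snd y))")
       (auto simp: clifford_group_def)
next
  fix x y z
  assume xyz: "x \<in> carrier (clifford_group n)" "y \<in> carrier (clifford_group n)"
    "z \<in> carrier (clifford_group n)"
  obtain e A where x: "x = (e, A)" by fastforce
  obtain e' B where y: "y = (e', B)" by fastforce
  obtain e'' C where z: "z = (e'', C)" by fastforce
  have "finite A" "finite B" "finite C"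
    using xyz by (auto simp: x y z clifford_group_def intro: finite_subset)
  then show "x \<otimes>\<^bsub>clifford_group n\<^esub> y \<otimes>\<^bsub>clifford_group n\<^esub> z
      = x \<otimes>\<^bsub>clifford_group n\<^esub> (y \<otimes>\<^bsub>clifford_group n\<^esub> z)"
    by (simp add: x y z clifford_group_def sign_inversions_sym_diff_left
        sign_inversions_sym_diff_right) blast
next
  show "\<one>\<^bsub>clifford_group n\<^esub> \<in> carrier (clifford_group n)"
    by (simp add: clifford_group_def)
next
  fix x assume "x \<in> carrier (clifford_group n)"
  then show "\<one>\<^bsub>clifford_group n\<^esub> \<otimes>\<^bsub>clifford_group n\<^esub> x = x"
    by (auto simp: clifford_group_def inversions_def)
next
  fix x assume x: "x \<in> carrier (clifford_group n)"
  obtain e A where eA: "x = (e, A)" by fastforce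
  let ?y = "(e * (-1) ^ inversions A A, A)"
  have "?y \<in> carrier (clifford_group n)"
    using x by (cases "even (inversions A A)") (auto simp: eA clifford_group_def)
  moreover have "?y \<otimes>\<^bsub>clifford_group n\<^esub> x = \<one>\<^bsub>clifford_group n\<^esub>"
    using x by (cases "even (inversions A A)") (auto simp: eA clifford_group_def)
  ultimately show "\<exists>y\<in>carrier (clifford_group n).
      y \<otimes>\<^bsub>clifford_group n\<^esub> x = \<one>\<^bsub>clifford_group n\<^esub>" by blast
qed

lemma card_clifford_group: "card (carrier (clifford_group n)) = 2 ^ (n + 1)"
  by (simp add: clifford_group_def card_cartesian_product card_Pow)

text \<open>Hence \<open>clifford_group m\<close> is the subgroup \<open>{\<plusminus>\<gamma>\<^sub>A | A \<subseteq> {1..m}}\<close> of \<open>clifford_group n\<close> on the nose.\<close>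

lemma clifford_group_restrict:
  "(clifford_group n)\<lparr>carrier := {1, -1} \<times> Pow {1..m}\<rparr> = clifford_group m"
  by (simp add: clifford_group_def)

lemma clifford_group_subgroup:
  assumes "m \<le> n"
  shows "subgroup (carrier (clifford_group m)) (clifford_group n)"
proof (rule group.group_incl_imp_subgroup[OF clifford_group_is_group])
  show "carrier (clifford_group m) \<subseteq> carrier (clifford_group n)"
    using assms by (auto simp: clifford_group_def)
  have "(clifford_group n)\<lparr>carrier := carrier (clifford_group m)\<rparr> = clifford_group m"
    by (simp add: clifford_group_def)
  then show "group ((clifford_group n)\<lparr>carrier := carrier (clifford_group m)\<rparr>)"
    using clifford_group_is_group by simp
qed

lemma clifford_triple_group:
  "group (clifford_group n \<times>\<times> clifford_group n \<times>\<times> clifford_group m)"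
  by (intro DirProd_group clifford_group_is_group)

lemma clifford_triple_finite:
  "finite (carrier (clifford_group n \<times>\<times> clifford_group n \<times>\<times> clifford_group m))"
  by (simp add: DirProd_def clifford_group_def)

lemma clifford_diag3_subgroup:
  assumes "m \<le> n"
  shows "subgroup (diag3 (carrier (clifford_group m)))
    (clifford_group n \<times>\<times> clifford_group n \<times>\<times> clifford_group m)"
proof -
  let ?G = "clifford_group n" and ?H = "clifford_group m"
  interpret G: group ?G by (rule clifford_group_is_group)
  interpret H: group ?H by (rule clifford_group_is_group)
  have sub: "subgroup (carrier ?H) ?G" by (rule clifford_group_subgroup[OF assms])
  have mult: "x \<otimes>\<^bsub>?G\<^esub> y = x \<otimes>\<^bsub>?H\<^esub> y" for x y by (simp add: clifford_group_def)
  have one: "\<one>\<^bsub>?G\<^esub> = \<one>\<^bsub>?H\<^esub>" by (simp add: clifford_group_def)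
  have mem: "x \<in> carrier ?G" if "x \<in> carrier ?H" for x
    using that sub subgroup.subset by blast
  have inv: "inv\<^bsub>?G\<^esub> x = inv\<^bsub>?H\<^esub> x" if x: "x \<in> carrier ?H" for x
    by (rule G.inv_equality) (use x mem one mult in simp_all)
  show ?thesis
  proof (rule group.subgroupI[OF clifford_triple_group])
    show "diag3 (carrier ?H) \<subseteq> carrier (?G \<times>\<times> ?G \<times>\<times> ?H)"
      using mem by (auto simp: diag3_def)
    show "diag3 (carrier ?H) \<noteq> {}"
      using H.one_closed unfolding diag3_def by blast
  next
    fix x assume "x \<in> diag3 (carrier ?H)"
    then obtain h where h: "h \<in> carrier ?H" "x = (h, h, h)" by (auto simp: diag3_def)
    then have "inv\<^bsub>?G \<times>\<times> ?G \<times>\<times> ?H\<^esub> x = (inv\<^bsub>?H\<^esub> h, inv\<^bsub>?H\<^esub> h, inv\<^bsub>?H\<^esub> h)"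
      using mem inv by (simp add: inv_DirProd clifford_group_is_group DirProd_group)
    then show "inv\<^bsub>?G \<times>\<times> ?G \<times>\<times> ?H\<^esub> x \<in> diag3 (carrier ?H)"
      using h(1) H.inv_closed unfolding diag3_def by blast
  next
    fix x y assume "x \<in> diag3 (carrier ?H)" "y \<in> diag3 (carrier ?H)"
    then obtain h k where hk: "h \<in> carrier ?H" "k \<in> carrier ?H" "x = (h, h, h)" "y = (k, k, k)"
      by (auto simp: diag3_def)
    then have "x \<otimes>\<^bsub>?G \<times>\<times> ?G \<times>\<times> ?H\<^esub> y = (h \<otimes>\<^bsub>?H\<^esub> k, h \<otimes>\<^bsub>?H\<^esub> k, h \<otimes>\<^bsub>?H\<^esub> k)"
      by (simp add: mult)
    then show "x \<otimes>\<^bsub>?G \<times>\<times> ?G \<times>\<times> ?H\<^esub> y \<in> diag3 (carrier ?H)"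
      using hk(1,2) H.m_closed unfolding diag3_def by blast
  qed
qed

end

theory Submission
  imports Defs
begin

text \<open>Both parts are instances of one fact about a finite group \<open>G\<close> whose commutators lie in
  \<open>{\<one>, z}\<close> for a central involution \<open>z\<close>, and a subgroup \<open>H\<close> that contains \<open>z\<close>:
  the pair of \<open>G \<times> G \<times> H\<close> and the diagonal \<open>K\<close> of \<open>H\<close> is a Gelfand pair
  if and only if every element of \<open>G\<close> that centralizes \<open>H\<close> is central in \<open>G\<close>
  (\<open>gelfand_diag3_iff_centralizer_central\<close>).

  Necessity. In a Gelfand pair the indicator functions of two double cosets commute, so that
  \<open>x y \<in> K y K x K\<close> for all \<open>x\<close> and \<open>y\<close> (\<open>gelfand_pair_imp_double_coset_swap\<close>). Let \<open>w\<close>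
  centralize \<open>H\<close>. Then \<open>x = (\<one>, w, \<one>)\<close> centralizes \<open>K\<close>, and with \<open>y = (g, g, \<one>)\<close> this gives
  \<open>(g, w g, \<one>) = (k g k', k g k' w, k k')\<close>; the first component turns the second into
  \<open>w g = g w\<close>.

  Sufficiency. Two elements \<open>u\<close> and \<open>v\<close> of \<open>G \<times> G \<times> H\<close> commute up to an element of
  the central subgroup \<open>Z = {\<one>, z}\<^sup>3\<close>. If this element is a product \<open>s t\<close> with \<open>s u \<in> K u K\<close>
  and \<open>t v \<in> K v K\<close>, then bi-\<open>K\<close>-invariant functions do not notice it after averaging over \<open>Z\<close>,
  and their convolution is commutative (\<open>gelfand_pair_if_commute_up_to_central\<close>). The elements
  \<open>s\<close> that are available for \<open>u\<close> are the commutators of \<open>u\<close> with \<open>K\<close>, times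
  \<open>(z, z, z) \<in> K\<close>. So the products \<open>s t\<close> form a subspace of \<open>Z\<close>, which is a vector space over the
  field with two elements, and this subspace contains \<open>(z, z, z)\<close>. It is cut out by the functionals
  that compare two of the three coordinates. If such a functional vanishes on it, then the quotients
  of the two components of \<open>u\<close>, and those of \<open>v\<close>, centralize \<open>H\<close>; hence they are central, and so
  the functional vanishes on the commutator of \<open>u\<close> and \<open>v\<close> too.

  In the Clifford group \<open>\<gamma>\<^sub>A\<close> and \<open>\<gamma>\<^sub>B\<close> commute if and only if \<open>|A| |B| + |A \<inter> B|\<close> is even.
  Part (i) is the trivial case \<open>H = G\<close>. For odd \<open>n\<close> the element \<open>\<gamma>\<^sub>A\<close> with \<open>A = {1..n}\<close> is central,
  and multiplication by it replaces each \<open>B\<close> by its complement, up to sign; so \<open>G\<close> is generated by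
  \<open>H\<close> and the centre. For even \<open>n\<close> the element \<open>\<gamma>\<^sub>A\<close> with \<open>A = {1..n - 1}\<close> centralizes \<open>H\<close>, but
  it anticommutes with \<open>\<gamma>\<^sub>B\<close> for \<open>B = {n}\<close>.\<close>

section \<open>Criteria for Gelfand pairs\<close>

lemma bi_invariantD:
  assumes "f \<in> bi_invariant G K" "g \<in> carrier G" "k1 \<in> K" "k2 \<in> K"
  shows "f (k1 \<otimes>\<^bsub>G\<^esub> g \<otimes>\<^bsub>G\<^esub> k2) = f g"
  using assms by (auto simp: bi_invariant_def)

context group
begin

lemma mult_inv_cancel [simp]:
  assumes "x \<in> carrier G" "y \<in> carrier G"
  shows "x \<otimes> (inv x \<otimes> y) = y" "inv x \<otimes> (x \<otimes> y) = y"
  using assms by (simp_all flip: m_assoc)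

lemma bij_betw_mult_left:
  assumes "subgroup Z G" "s \<in> Z"
  shows "bij_betw (\<lambda>\<zeta>. s \<otimes> \<zeta>) Z Z"
proof (rule bij_betw_byWitness[where f' = "\<lambda>\<zeta>. inv s \<otimes> \<zeta>"])
  have "z \<in> carrier G" if "z \<in> Z" for z
    using that assms subgroup.mem_carrier by metis
  then show "\<forall>\<zeta>\<in>Z. inv s \<otimes> (s \<otimes> \<zeta>) = \<zeta>" "\<forall>\<zeta>\<in>Z. s \<otimes> (inv s \<otimes> \<zeta>) = \<zeta>"
    using assms(2) by (simp_all flip: m_assoc)
qed (use assms in \<open>auto simp: subgroup.m_closed subgroup.m_inv_closed\<close>)

text \<open>After the substitution \<open>h = g u\<inverse>\<close> the sum is weighted by \<open>f1 u\<close>, as the one for the opposite order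
  of the factors is, so that commutativity becomes a comparison of the values of \<open>f2\<close> at \<open>v = u\<inverse> g\<close> and at
  \<open>g u\<inverse> = u v u\<inverse>\<close>.\<close>

lemma convolution_swap:
  assumes "g \<in> carrier G"
  shows "convolution G f2 f1 g = (\<Sum>u\<in>carrier G. f1 u * f2 (g \<otimes> inv u))"
proof -
  have "bij_betw (\<lambda>u. g \<otimes> inv u) (carrier G) (carrier G)"
    by (rule bij_betw_byWitness[where f' = "\<lambda>h. inv h \<otimes> g"])
       (use assms in \<open>auto simp: inv_mult_group m_assoc\<close>)
  then have "(\<Sum>h\<in>carrier G. f2 h * f1 (inv h \<otimes> g))
      = (\<Sum>u\<in>carrier G. f2 (g \<otimes> inv u) * f1 (inv (g \<otimes> inv u) \<otimes> g))"
    by (rule sum.reindex_bij_betw[symmetric])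
  also have "\<dots> = (\<Sum>u\<in>carrier G. f1 u * f2 (g \<otimes> inv u))"
    using assms by (intro sum.cong) (auto simp: inv_mult_group m_assoc)
  finally show ?thesis using assms by (simp add: convolution_def)
qed

text \<open>For fixed \<open>u\<close> and \<open>v = u\<inverse> g\<close> the two values of \<open>f2\<close> to be compared are those at \<open>v\<close> and at
  \<open>u v u\<inverse> = s t v\<close>. These differ in general; but in the sum of
  \<open>f1 (\<zeta> u) * f2 (\<zeta>\<inverse> s t v)\<close> over \<open>\<zeta> \<in> Z\<close> the factor \<open>t\<close> is absorbed by the invariance of \<open>f2\<close>,
  while the shift \<open>\<zeta> \<mapsto> s \<zeta>\<close> moves \<open>s\<close> to \<open>f1\<close>, where it is absorbed as well.\<close>

lemma gelfand_pair_if_commute_up_to_central: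
  assumes fin: "finite (carrier G)" and K: "K \<subseteq> carrier G" and Z: "subgroup Z G"
    and central: "\<And>\<zeta> x. \<zeta> \<in> Z \<Longrightarrow> x \<in> carrier G \<Longrightarrow> x \<otimes> \<zeta> = \<zeta> \<otimes> x"
    and swap: "\<And>u v. u \<in> carrier G \<Longrightarrow> v \<in> carrier G \<Longrightarrow> \<exists>s\<in>Z. \<exists>t\<in>Z.
      (\<exists>k1\<in>K. \<exists>k2\<in>K. s \<otimes> u = k1 \<otimes> u \<otimes> k2) \<and> (\<exists>k1\<in>K. \<exists>k2\<in>K. t \<otimes> v = k1 \<otimes> v \<otimes> k2) \<and>
      u \<otimes> v = s \<otimes> t \<otimes> (v \<otimes> u)"
  shows "gelfand_pair G K"
  unfolding gelfand_pair_def
proof (intro ballI ext)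
  fix f1 f2 g
  assume f: "f1 \<in> bi_invariant G K" "f2 \<in> bi_invariant G K"
  have Zc: "\<zeta> \<in> carrier G" if "\<zeta> \<in> Z" for \<zeta> using that Z subgroup.mem_carrier by metis
  have finZ: "finite Z" by (rule finite_subset[OF _ fin]) (use Zc in blast)
  have absorb: "f (\<zeta> \<otimes> (s \<otimes> x)) = f (\<zeta> \<otimes> x)"
    if "f \<in> bi_invariant G K" "\<zeta> \<in> Z" "x \<in> carrier G" "k1 \<in> K" "k2 \<in> K"
      "s \<otimes> x = k1 \<otimes> x \<otimes> k2" for f \<zeta> s x k1 k2
  proof -
    have "k1 \<in> carrier G" "k2 \<in> carrier G" using that K by auto
    then have "\<zeta> \<otimes> (k1 \<otimes> x \<otimes> k2) = k1 \<otimes> (\<zeta> \<otimes> x) \<otimes> k2"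
      using that(2,3) Zc central[OF that(2), of k1] by (simp flip: m_assoc)
    then show ?thesis using that Zc by (simp add: bi_invariantD)
  qed
  have average: "of_nat (card Z) * (\<Sum>u\<in>carrier G. F u)
      = (\<Sum>u\<in>carrier G. \<Sum>\<zeta>\<in>Z. F (\<zeta> \<otimes> u))" for F :: "'a \<Rightarrow> complex"
  proof -
    have "(\<Sum>u\<in>carrier G. F (\<zeta> \<otimes> u)) = (\<Sum>u\<in>carrier G. F u)" if "\<zeta> \<in> Z" for \<zeta>
      by (rule sum.reindex_bij_betw) (use that Zc subgroup_self in \<open>auto intro: bij_betw_mult_left\<close>)
    then have "(\<Sum>\<zeta>\<in>Z. \<Sum>u\<in>carrier G. F (\<zeta> \<otimes> u)) = of_nat (card Z) * (\<Sum>u\<in>carrier G. F u)"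
      by simp
    then show ?thesis by (simp add: sum.swap[of _ "carrier G"])
  qed
  show "convolution G f1 f2 g = convolution G f2 f1 g"
  proof (cases "g \<in> carrier G")
    case g: True
    have fibre: "(\<Sum>\<zeta>\<in>Z. f1 (\<zeta> \<otimes> u) * f2 (inv (\<zeta> \<otimes> u) \<otimes> g))
        = (\<Sum>\<zeta>\<in>Z. f1 (\<zeta> \<otimes> u) * f2 (g \<otimes> inv (\<zeta> \<otimes> u)))" if u: "u \<in> carrier G" for u
    proof -
      define v where "v = inv u \<otimes> g"
      have v: "v \<in> carrier G" using u g by (simp add: v_def)
      obtain s t k1 k2 l1 l2 where st: "s \<in> Z" "t \<in> Z"
        and s: "k1 \<in> K" "k2 \<in> K" "s \<otimes> u = k1 \<otimes> u \<otimes> k2"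
        and t: "l1 \<in> K" "l2 \<in> K" "t \<otimes> v = l1 \<otimes> v \<otimes> l2"
        and uv: "u \<otimes> v = s \<otimes> t \<otimes> (v \<otimes> u)"
        using swap[OF u v] by blast
      note c = u v g st[THEN Zc]
      have "g = u \<otimes> v" using c by (simp add: v_def flip: m_assoc)
      then have gu: "g \<otimes> inv u = s \<otimes> (t \<otimes> v)"
        unfolding uv using c by (simp add: m_assoc)
      have left: "inv (\<zeta> \<otimes> u) \<otimes> g = inv \<zeta> \<otimes> v" if \<zeta>: "\<zeta> \<in> Z" for \<zeta>
        using c Zc[OF \<zeta>] central[of "inv \<zeta>" "inv u"] \<zeta> subgroup.m_inv_closed[OF Z]
        by (simp add: inv_mult_group v_def flip: m_assoc)
      have right: "g \<otimes> inv (\<zeta> \<otimes> u) = inv \<zeta> \<otimes> (g \<otimes> inv u)" if \<zeta>: "\<zeta> \<in> Z" for \<zeta>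
        using c Zc[OF \<zeta>] central[of "inv \<zeta>" "g \<otimes> inv u"] \<zeta> subgroup.m_inv_closed[OF Z]
        by (simp add: inv_mult_group flip: m_assoc)
      have "(\<Sum>\<zeta>\<in>Z. f1 (\<zeta> \<otimes> u) * f2 (g \<otimes> inv (\<zeta> \<otimes> u)))
          = (\<Sum>\<zeta>\<in>Z. f1 (\<zeta> \<otimes> u) * f2 (inv \<zeta> \<otimes> (s \<otimes> (t \<otimes> v))))"
        using right gu by simp
      also have "\<dots> = (\<Sum>\<zeta>\<in>Z. f1 (s \<otimes> \<zeta> \<otimes> u) * f2 (inv (s \<otimes> \<zeta>) \<otimes> (s \<otimes> (t \<otimes> v))))"
        by (rule sum.reindex_bij_betw[OF bij_betw_mult_left[OF Z st(1)], symmetric])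
      also have "\<dots> = (\<Sum>\<zeta>\<in>Z. f1 (\<zeta> \<otimes> u) * f2 (inv \<zeta> \<otimes> v))"
      proof (intro sum.cong refl)
        fix \<zeta> assume \<zeta>: "\<zeta> \<in> Z"
        have "s \<otimes> \<zeta> \<otimes> u = \<zeta> \<otimes> (s \<otimes> u)"
          using c Zc[OF \<zeta>] central[OF \<zeta>, of s] by (simp flip: m_assoc)
        then have 1: "f1 (s \<otimes> \<zeta> \<otimes> u) = f1 (\<zeta> \<otimes> u)"
          using absorb[OF f(1) \<zeta> u s] by simp
        have "inv (s \<otimes> \<zeta>) \<otimes> (s \<otimes> (t \<otimes> v)) = inv \<zeta> \<otimes> (t \<otimes> v)"
          using c Zc[OF \<zeta>] by (simp add: inv_mult_group m_assoc)
        then have 2: "f2 (inv (s \<otimes> \<zeta>) \<otimes> (s \<otimes> (t \<otimes> v))) = f2 (inv \<zeta> \<otimes> v)"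
          using absorb[OF f(2) subgroup.m_inv_closed[OF Z \<zeta>] v t] by simp
        show "f1 (s \<otimes> \<zeta> \<otimes> u) * f2 (inv (s \<otimes> \<zeta>) \<otimes> (s \<otimes> (t \<otimes> v)))
            = f1 (\<zeta> \<otimes> u) * f2 (inv \<zeta> \<otimes> v)"
          by (simp only: 1 2)
      qed
      finally show ?thesis using left by simp
    qed
    have "of_nat (card Z) * convolution G f1 f2 g
        = (\<Sum>u\<in>carrier G. \<Sum>\<zeta>\<in>Z. f1 (\<zeta> \<otimes> u) * f2 (inv (\<zeta> \<otimes> u) \<otimes> g))"
      using g by (simp add: convolution_def average)
    also have "\<dots> = (\<Sum>u\<in>carrier G. \<Sum>\<zeta>\<in>Z. f1 (\<zeta> \<otimes> u) * f2 (g \<otimes> inv (\<zeta> \<otimes> u)))"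
      by (rule sum.cong[OF refl fibre])
    also have "\<dots> = of_nat (card Z) * convolution G f2 f1 g"
      unfolding convolution_swap[OF g] average ..
    finally have "of_nat (card Z) * convolution G f1 f2 g = of_nat (card Z) * convolution G f2 f1 g" .
    moreover have "card Z \<noteq> 0"
      using finZ subgroup.one_closed[OF Z] by auto
    ultimately show ?thesis by simp
  qed (simp add: convolution_def)
qed

text \<open>Convolving the indicator functions of \<open>K a K\<close> and \<open>K b K\<close> counts factorizations, so the result is
  nonzero exactly on \<open>K a K b K\<close>. As \<open>x y\<close> lies in \<open>K x K y K\<close>, commutativity puts it into
  \<open>K y K x K\<close>.\<close>

lemma gelfand_pair_imp_double_coset_swap:
  assumes fin: "finite (carrier G)" and K: "subgroup K G" and gel: "gelfand_pair G K"
    and x: "x \<in> carrier G" and y: "y \<in> carrier G"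
  shows "\<exists>k1\<in>K. \<exists>k2\<in>K. \<exists>k3\<in>K. x \<otimes> y = k1 \<otimes> y \<otimes> k2 \<otimes> x \<otimes> k3"
proof -
  have Kc: "k \<in> carrier G" if "k \<in> K" for k using that K subgroup.mem_carrier by metis
  note K_closed = subgroup.m_closed[OF K] subgroup.m_inv_closed[OF K] subgroup.one_closed[OF K]
  define D where "D a = {k1 \<otimes> a \<otimes> k2 | k1 k2. k1 \<in> K \<and> k2 \<in> K}" for a
  define f :: "'a \<Rightarrow> 'a \<Rightarrow> complex" where
    "f a = (\<lambda>g\<in>carrier G. if g \<in> D a then 1 else 0)" for a
  have D_self: "a \<in> D a" if "a \<in> carrier G" for a
    using that K_closed(3) unfolding D_def by force
  have D_mult: "k1 \<otimes> g \<otimes> k2 \<in> D a" if "g \<in> D a" "k1 \<in> K" "k2 \<in> K" "a \<in> carrier G" for a g k1 k2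
  proof -
    from that(1) obtain l1 l2 where l: "l1 \<in> K" "l2 \<in> K" "g = l1 \<otimes> a \<otimes> l2"
      unfolding D_def by blast
    have "k1 \<otimes> g \<otimes> k2 = (k1 \<otimes> l1) \<otimes> a \<otimes> (l2 \<otimes> k2)"
      using l that Kc by (simp add: m_assoc)
    then show ?thesis using l that K_closed unfolding D_def by blast
  qed
  have D_iff: "k1 \<otimes> g \<otimes> k2 \<in> D a \<longleftrightarrow> g \<in> D a"
    if "g \<in> carrier G" "k1 \<in> K" "k2 \<in> K" "a \<in> carrier G" for a g k1 k2
  proof
    assume "k1 \<otimes> g \<otimes> k2 \<in> D a"
    then have "inv k1 \<otimes> (k1 \<otimes> g \<otimes> k2) \<otimes> inv k2 \<in> D a"
      using that K_closed(2) D_mult[of "k1 \<otimes> g \<otimes> k2" a "inv k1" "inv k2"] by simp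
    moreover have "inv k1 \<otimes> (k1 \<otimes> g \<otimes> k2) \<otimes> inv k2 = g"
      using that Kc by (simp add: m_assoc)
    ultimately show "g \<in> D a" by simp
  qed (use that D_mult in blast)
  have f_inv: "f a \<in> bi_invariant G K" if "a \<in> carrier G" for a
    unfolding bi_invariant_def f_def using that Kc D_iff by auto
  have eq: "convolution G (f x) (f y) (x \<otimes> y) = convolution G (f y) (f x) (x \<otimes> y)"
    using gel f_inv[OF x] f_inv[OF y] unfolding gelfand_pair_def by metis
  have conv: "convolution G (f a) (f b) (x \<otimes> y)
      = of_nat (card {h \<in> carrier G. h \<in> D a \<and> inv h \<otimes> (x \<otimes> y) \<in> D b})" for a b
  proof -
    have "convolution G (f a) (f b) (x \<otimes> y)
        = (\<Sum>h\<in>carrier G. if h \<in> D a \<and> inv h \<otimes> (x \<otimes> y) \<in> D b then 1 else 0)"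
      unfolding convolution_def using x y by (auto simp: f_def intro!: sum.cong)
    also have "\<dots> = of_nat (card {h \<in> carrier G. h \<in> D a \<and> inv h \<otimes> (x \<otimes> y) \<in> D b})"
      using fin by (simp flip: sum.inter_filter)
    finally show ?thesis .
  qed
  have "x \<in> {h \<in> carrier G. h \<in> D x \<and> inv h \<otimes> (x \<otimes> y) \<in> D y}"
    using x y D_self by (simp flip: m_assoc)
  then have "card {h \<in> carrier G. h \<in> D x \<and> inv h \<otimes> (x \<otimes> y) \<in> D y} \<noteq> 0"
    using fin by auto
  then have "card {h \<in> carrier G. h \<in> D y \<and> inv h \<otimes> (x \<otimes> y) \<in> D x} \<noteq> 0"
    using eq by (simp add: conv del: card_eq_0_iff)
  then have "{h \<in> carrier G. h \<in> D y \<and> inv h \<otimes> (x \<otimes> y) \<in> D x} \<noteq> {}"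
    by (metis card.empty)
  then obtain h where h: "h \<in> carrier G" "h \<in> D y" "inv h \<otimes> (x \<otimes> y) \<in> D x" by blast
  obtain k1 k2 where k: "k1 \<in> K" "k2 \<in> K" "h = k1 \<otimes> y \<otimes> k2" using h(2) unfolding D_def by blast
  obtain l1 l2 where l: "l1 \<in> K" "l2 \<in> K" "inv h \<otimes> (x \<otimes> y) = l1 \<otimes> x \<otimes> l2"
    using h(3) unfolding D_def by blast
  have "x \<otimes> y = h \<otimes> (l1 \<otimes> x \<otimes> l2)"
    using h(1) x y by (simp flip: l(3) m_assoc)
  also have "\<dots> = k1 \<otimes> y \<otimes> (k2 \<otimes> l1) \<otimes> x \<otimes> l2"
    using k l x y Kc by (simp add: m_assoc)
  finally show ?thesis using k l K_closed by blast
qed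

end

section \<open>Groups in which commutators are signs\<close>

lemma diag3_subgroup:
  assumes "group G" "subgroup H G"
  shows "subgroup (diag3 H) (G \<times>\<times> G \<times>\<times> G\<lparr>carrier := H\<rparr>)"
proof -
  interpret G: group G by fact
  have H: "group (G\<lparr>carrier := H\<rparr>)" by (simp add: assms G.subgroup_imp_group)
  note sub = subgroup.mem_carrier[OF assms(2)]
  show ?thesis
  proof (rule group.subgroupI)
    show "group (G \<times>\<times> G \<times>\<times> G\<lparr>carrier := H\<rparr>)" by (intro DirProd_group assms(1) H)
    show "diag3 H \<subseteq> carrier (G \<times>\<times> G \<times>\<times> G\<lparr>carrier := H\<rparr>)"
      using sub by (auto simp: diag3_def)
    show "diag3 H \<noteq> {}" using subgroup.one_closed[OF assms(2)] by (auto simp: diag3_def)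
  next
    fix a assume "a \<in> diag3 H"
    then show "inv\<^bsub>G \<times>\<times> G \<times>\<times> G\<lparr>carrier := H\<rparr>\<^esub> a \<in> diag3 H"
      using sub assms H subgroup.m_inv_closed[OF assms(2)]
      by (auto simp: diag3_def inv_DirProd DirProd_group G.m_inv_consistent)
  qed (auto simp: diag3_def intro: subgroup.m_closed[OF assms(2)])
qed

lemma gelfand_diag3_imp_centralizer_central:
  fixes G (structure)
  assumes "group G" "finite (carrier G)" "subgroup H G"
    and gel: "gelfand_pair (G \<times>\<times> G \<times>\<times> G\<lparr>carrier := H\<rparr>) (diag3 H)"
    and w: "w \<in> carrier G" "\<And>h. h \<in> H \<Longrightarrow> h \<otimes> w = w \<otimes> h" and g: "g \<in> carrier G"
  shows "g \<otimes> w = w \<otimes> g"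
proof -
  interpret G: group G by fact
  note sub = subgroup.mem_carrier[OF assms(3)]
  have H: "group (G\<lparr>carrier := H\<rparr>)" by (simp add: assms G.subgroup_imp_group)
  have fin: "finite (carrier (G \<times>\<times> G \<times>\<times> G\<lparr>carrier := H\<rparr>))"
    using assms(2) sub by (auto simp: DirProd_def intro: finite_subset)
  have one: "\<one> \<in> H" by (rule subgroup.one_closed[OF assms(3)])
  \<comment> \<open>\<open>(\<one>, w, \<one>)\<close> centralizes the diagonal, and only its second component can tell the two
    orders of multiplication apart.\<close>
  have "\<exists>k1\<in>diag3 H. \<exists>k2\<in>diag3 H. \<exists>k3\<in>diag3 H.
      (\<one>, w, \<one>) \<otimes>\<^bsub>G \<times>\<times> G \<times>\<times> G\<lparr>carrier := H\<rparr>\<^esub> (g, g, \<one>) =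
      k1 \<otimes>\<^bsub>G \<times>\<times> G \<times>\<times> G\<lparr>carrier := H\<rparr>\<^esub> (g, g, \<one>) \<otimes>\<^bsub>G \<times>\<times> G \<times>\<times> G\<lparr>carrier := H\<rparr>\<^esub> k2
        \<otimes>\<^bsub>G \<times>\<times> G \<times>\<times> G\<lparr>carrier := H\<rparr>\<^esub> (\<one>, w, \<one>) \<otimes>\<^bsub>G \<times>\<times> G \<times>\<times> G\<lparr>carrier := H\<rparr>\<^esub> k3"
    by (rule group.gelfand_pair_imp_double_coset_swap[OF _ fin diag3_subgroup gel])
       (use assms H one in \<open>auto intro!: DirProd_group\<close>)
  then obtain a b c where abc: "a \<in> H" "b \<in> H" "c \<in> H"
    and 1: "\<one> \<otimes> g = a \<otimes> g \<otimes> b \<otimes> \<one> \<otimes> c" and 2: "w \<otimes> g = a \<otimes> g \<otimes> b \<otimes> w \<otimes> c"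
    by (auto simp: diag3_def)
  note m = abc[THEN sub] w(1) g
  have "w \<otimes> g = a \<otimes> g \<otimes> b \<otimes> c \<otimes> w"
    unfolding 2 using m w(2)[OF abc(3)] by (simp add: G.m_assoc)
  also have "\<dots> = g \<otimes> w" using 1 m by simp
  finally show ?thesis ..
qed

locale sign_commutator_group = group G for G (structure) +
  fixes z
  assumes z_closed: "z \<in> carrier G" and z_square: "z \<otimes> z = \<one>" and z_neq_one: "z \<noteq> \<one>"
    and z_central: "x \<in> carrier G \<Longrightarrow> x \<otimes> z = z \<otimes> x"
    and commutator: "\<lbrakk>x \<in> carrier G; y \<in> carrier G\<rbrakk> \<Longrightarrow> x \<otimes> y = y \<otimes> x \<or> x \<otimes> y = z \<otimes> (y \<otimes> x)"
begin

definition sign :: "bool \<Rightarrow> 'a" where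
  "sign b = (if b then z else \<one>)"

text \<open>The commutator as a bit: if \<open>x\<close> and \<open>y\<close> do not commute, then \<open>x y = z y x\<close>. Since
  \<open>z\<close> is central of order two, this bit is bimultiplicative.\<close>

definition anti :: "'a \<Rightarrow> 'a \<Rightarrow> bool" where
  "anti x y \<longleftrightarrow> x \<otimes> y \<noteq> y \<otimes> x"

lemma sign_closed [simp]: "sign b \<in> carrier G"
  by (simp add: sign_def z_closed)

lemma sign_mult: "sign b \<otimes> sign c = sign (b \<noteq> c)"
  by (simp add: sign_def z_square z_closed)

lemma sign_central: "x \<in> carrier G \<Longrightarrow> x \<otimes> sign b = sign b \<otimes> x"
  by (simp add: sign_def z_central)

lemma anti_sym: "anti x y = anti y x"
  by (auto simp: anti_def)

lemma swap_sign: "\<lbrakk>x \<in> carrier G; y \<in> carrier G\<rbrakk> \<Longrightarrow> x \<otimes> y = sign (anti x y) \<otimes> (y \<otimes> x)"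
  using commutator[of x y] by (auto simp: anti_def sign_def)

lemma anti_mult:
  assumes "x \<in> carrier G" "x' \<in> carrier G" "y \<in> carrier G"
  shows "anti (x \<otimes> x') y \<longleftrightarrow> anti x y \<noteq> anti x' y"
proof -
  have "x \<otimes> x' \<otimes> y = x \<otimes> (sign (anti x' y) \<otimes> (y \<otimes> x'))"
    using assms swap_sign[of x' y] by (simp add: m_assoc)
  also have "\<dots> = sign (anti x' y) \<otimes> (x \<otimes> y \<otimes> x')"
    using assms sign_central[of x] by (simp flip: m_assoc)
  also have "\<dots> = sign (anti x' y) \<otimes> (sign (anti x y) \<otimes> (y \<otimes> x) \<otimes> x')"
    using assms swap_sign[of x y] by simp
  also have "\<dots> = sign (anti x' y) \<otimes> sign (anti x y) \<otimes> (y \<otimes> (x \<otimes> x'))"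
    using assms by (simp add: m_assoc)
  also have "\<dots> = sign (anti x' y \<noteq> anti x y) \<otimes> (y \<otimes> (x \<otimes> x'))"
    by (simp only: sign_mult)
  finally have eq: "x \<otimes> x' \<otimes> y = sign (anti x' y \<noteq> anti x y) \<otimes> (y \<otimes> (x \<otimes> x'))" .
  show ?thesis
    unfolding anti_def[of "x \<otimes> x'"] eq using assms z_neq_one z_closed
    by (auto simp: sign_def l_cancel_one)
qed

lemma conj_sign:
  assumes "x \<in> carrier G" "k \<in> carrier G"
  shows "sign (b \<noteq> anti k x) \<otimes> x = sign b \<otimes> k \<otimes> x \<otimes> inv k"
proof -
  have "sign b \<otimes> k \<otimes> x \<otimes> inv k = sign b \<otimes> (k \<otimes> x) \<otimes> inv k"
    using assms by (simp add: m_assoc)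
  also have "\<dots> = sign b \<otimes> sign (anti k x) \<otimes> x"
    using assms swap_sign[of k x] by (simp add: m_assoc)
  finally show ?thesis by (simp add: sign_mult)
qed

end

text \<open>A subspace of the plane over the field with two elements contains \<open>(d, e)\<close> as soon as each of the
  three nonzero functionals, namely the two coordinates and their sum, that takes the value 1 at
  \<open>(d, e)\<close> also takes it on the subspace. Here the subspace is the image of \<open>S\<close> under \<open>(p, q)\<close>.\<close>

lemma exists_with_bits:
  fixes p q :: "'a \<Rightarrow> bool"
  assumes "S \<noteq> {}"
    and "\<And>x y. x \<in> S \<Longrightarrow> y \<in> S \<Longrightarrow> \<exists>w\<in>S. p w = (p x \<noteq> p y) \<and> q w = (q x \<noteq> q y)"
    and "d \<Longrightarrow> \<exists>x\<in>S. p x" and "e \<Longrightarrow> \<exists>x\<in>S. q x" and "d \<noteq> e \<Longrightarrow> \<exists>x\<in>S. p x \<noteq> q x"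
  shows "\<exists>x\<in>S. p x = d \<and> q x = e"
proof -
  have "\<exists>x\<in>S. \<not> p x \<and> \<not> q x" using assms(1,2) by blast
  then show ?thesis using assms by (cases d; cases e) metis+
qed

context sign_commutator_group
begin

text \<open>Conjugating \<open>u\<close> and \<open>v\<close> by the diagonal elements of some \<open>k\<close> and \<open>l\<close> in \<open>H\<close>, and multiplying by
  \<open>(z, z, z)\<close> if necessary, must produce the three commutator bits of \<open>u\<close> and \<open>v\<close>. The factor
  \<open>(z, z, z)\<close> takes care of the third bit, so only the differences of the first two bits from the
  third remain to be adjusted by \<open>(k, l)\<close>, which is a problem in the plane.\<close>

lemma gelfand_diag3_if_centralizer_central:
  assumes fin: "finite (carrier G)" and sub: "subgroup H G" and z: "z \<in> H"
    and central: "\<And>w g. \<lbrakk>w \<in> carrier G; \<And>h. h \<in> H \<Longrightarrow> h \<otimes> w = w \<otimes> h; g \<in> carrier G\<rbrakk>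
      \<Longrightarrow> g \<otimes> w = w \<otimes> g"
  shows "gelfand_pair (G \<times>\<times> G \<times>\<times> G\<lparr>carrier := H\<rparr>) (diag3 H)"
proof -
  let ?\<Gamma> = "G \<times>\<times> G \<times>\<times> G\<lparr>carrier := H\<rparr>"
  note Hc = subgroup.mem_carrier[OF sub]
  note H_closed = subgroup.m_closed[OF sub] subgroup.m_inv_closed[OF sub] subgroup.one_closed[OF sub]
  have grpH: "group (G\<lparr>carrier := H\<rparr>)" by (simp add: sub subgroup_imp_group)
  interpret \<Gamma>: group ?\<Gamma> by (intro DirProd_group grpH group_axioms)
  have signH: "sign b \<in> H" for b using z H_closed by (simp add: sign_def)
  have anti_one: "\<not> anti \<one> x" if "x \<in> carrier G" for x using that by (simp add: anti_def)
  \<comment> \<open>If \<open>a\<close> and \<open>b\<close> have the same commutators with \<open>H\<close>, then \<open>a b\<close> centralizes \<open>H\<close>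
    and is therefore central.\<close>
  have agree: "anti g a = anti g b"
    if "a \<in> carrier G" "b \<in> carrier G" "g \<in> carrier G" "\<And>h. h \<in> H \<Longrightarrow> anti h a = anti h b" for a b g
  proof -
    have m: "anti h (a \<otimes> b) \<longleftrightarrow> anti h a \<noteq> anti h b" if "h \<in> carrier G" for h
      using anti_mult[of a b h] \<open>a \<in> carrier G\<close> \<open>b \<in> carrier G\<close> that by (simp add: anti_sym)
    have "h \<otimes> (a \<otimes> b) = a \<otimes> b \<otimes> h" if "h \<in> H" for h
      using m[OF Hc[OF that]] \<open>h \<in> H\<close> \<open>\<And>h. h \<in> H \<Longrightarrow> anti h a = anti h b\<close> by (simp add: anti_def)
    then have "\<not> anti g (a \<otimes> b)" using central[of "a \<otimes> b" g] that by (simp add: anti_def)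
    then show ?thesis using m that by simp
  qed
  \<comment> \<open>Applied to two components \<open>(a, a')\<close> and \<open>(b, b')\<close> of \<open>(u, v)\<close>, this handles the functional
    that compares them.\<close>
  have separate: "\<exists>(k, l)\<in>H \<times> H. (anti k a \<noteq> anti l a') \<noteq> (anti k b \<noteq> anti l b')"
    if "anti a a' \<noteq> anti b b'" "a \<in> carrier G" "a' \<in> carrier G" "b \<in> carrier G" "b' \<in> carrier G"
    for a a' b b'
  proof (rule ccontr)
    assume "\<not> ?thesis"
    then have *: "(anti k a \<noteq> anti l a') = (anti k b \<noteq> anti l b')" if "k \<in> H" "l \<in> H" for k l
      using that by auto
    have "anti k a = anti k b" if "k \<in> H" for k
      using *[OF that H_closed(3)] anti_one \<open>a' \<in> carrier G\<close> \<open>b' \<in> carrier G\<close> by simp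
    moreover have "anti l a' = anti l b'" if "l \<in> H" for l
      using *[OF H_closed(3) that] anti_one \<open>a \<in> carrier G\<close> \<open>b \<in> carrier G\<close> by simp
    \<comment> \<open>Passing from \<open>(a, a')\<close> to \<open>(b, b')\<close> by changing one entry at a time.\<close>
    ultimately have "anti a' a = anti a' b" "anti b a' = anti b b'"
      using agree that by blast+
    then show False using that(1) by (simp add: anti_sym)
  qed
  define Z where "Z = range (\<lambda>(b1, b2, b3). (sign b1, sign b2, sign b3))"
  have ZI: "(sign b1, sign b2, sign b3) \<in> Z" for b1 b2 b3
    unfolding Z_def by (rule range_eqI[of _ _ "(b1, b2, b3)"]) simp
  have sign_inv: "inv (sign b) = sign b" for b
    using sign_mult[of b b] by (intro inv_equality) (auto simp: sign_def z_closed)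
  show ?thesis
  proof (rule \<Gamma>.gelfand_pair_if_commute_up_to_central[where Z = Z])
    show "finite (carrier ?\<Gamma>)"
      using fin Hc by (auto simp: DirProd_def intro: finite_subset)
    show "diag3 H \<subseteq> carrier ?\<Gamma>" using Hc by (auto simp: diag3_def)
    show "subgroup Z ?\<Gamma>"
    proof (rule \<Gamma>.subgroupI)
      show "Z \<subseteq> carrier ?\<Gamma>" using signH by (auto simp: Z_def)
      show "Z \<noteq> {}" using ZI by blast
    next
      fix a assume "a \<in> Z"
      then obtain b1 b2 b3 where a: "a = (sign b1, sign b2, sign b3)" by (auto simp: Z_def)
      have "inv\<^bsub>?\<Gamma>\<^esub> a = a"
        unfolding a using signH sub grpH group_axioms
        by (simp add: inv_DirProd DirProd_group m_inv_consistent sign_inv)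
      then show "inv\<^bsub>?\<Gamma>\<^esub> a \<in> Z" using \<open>a \<in> Z\<close> by simp
    next
      fix a b assume "a \<in> Z" "b \<in> Z"
      then show "a \<otimes>\<^bsub>?\<Gamma>\<^esub> b \<in> Z" using ZI by (auto simp: Z_def[unfolded image_def] sign_mult)
    qed
    show "x \<otimes>\<^bsub>?\<Gamma>\<^esub> \<zeta> = \<zeta> \<otimes>\<^bsub>?\<Gamma>\<^esub> x" if "\<zeta> \<in> Z" "x \<in> carrier ?\<Gamma>" for \<zeta> x
      using that Hc by (auto simp: Z_def sign_central)
  next
    fix u v assume "u \<in> carrier ?\<Gamma>" "v \<in> carrier ?\<Gamma>"
    then obtain a1 a2 a3 b1 b2 b3 where uv: "u = (a1, a2, a3)" "v = (b1, b2, b3)"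
      and c: "a1 \<in> carrier G" "a2 \<in> carrier G" "a3 \<in> carrier G"
        "b1 \<in> carrier G" "b2 \<in> carrier G" "b3 \<in> carrier G"
      using Hc by (auto simp: DirProd_def)
    \<comment> \<open>The bit produced in the component \<open>(i, j)\<close> of \<open>(u, v)\<close> by conjugation with \<open>k\<close> and \<open>l\<close>.\<close>
    define e where "e i j k l \<longleftrightarrow> anti k i \<noteq> anti l j" for i j k l
    have e_mult: "e i j (k \<otimes> k') (l \<otimes> l') \<longleftrightarrow> e i j k l \<noteq> e i j k' l'"
      if "i \<in> carrier G" "j \<in> carrier G" "k \<in> H" "k' \<in> H" "l \<in> H" "l' \<in> H" for i j k k' l l'
      using that Hc by (auto simp: e_def anti_mult)
    define p where "p = (\<lambda>(k, l). e a1 b1 k l \<noteq> e a3 b3 k l)"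
    define q where "q = (\<lambda>(k, l). e a2 b2 k l \<noteq> e a3 b3 k l)"
    have "\<exists>x\<in>H \<times> H. p x = (anti a1 b1 \<noteq> anti a3 b3) \<and> q x = (anti a2 b2 \<noteq> anti a3 b3)"
    proof (rule exists_with_bits)
      show "H \<times> H \<noteq> {}" using H_closed by blast
      show "\<exists>w\<in>H \<times> H. p w = (p x \<noteq> p y) \<and> q w = (q x \<noteq> q y)"
        if xy: "x \<in> H \<times> H" "y \<in> H \<times> H" for x y
      proof -
        obtain k l k' l' where kl: "x = (k, l)" "y = (k', l')" "k \<in> H" "l \<in> H" "k' \<in> H" "l' \<in> H"
          using xy by auto
        have "(k \<otimes> k', l \<otimes> l') \<in> H \<times> H" using kl H_closed by simp
        moreover have "p (k \<otimes> k', l \<otimes> l') = (p x \<noteq> p y)" "q (k \<otimes> k', l \<otimes> l') = (q x \<noteq> q y)"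
          using kl c by (auto simp: p_def q_def e_mult)
        ultimately show ?thesis by blast
      qed
      show "\<exists>x\<in>H \<times> H. p x" if "anti a1 b1 \<noteq> anti a3 b3"
        using separate[OF that] c by (auto simp: p_def e_def)
      show "\<exists>x\<in>H \<times> H. q x" if "anti a2 b2 \<noteq> anti a3 b3"
        using separate[OF that] c by (auto simp: q_def e_def)
      show "\<exists>x\<in>H \<times> H. p x \<noteq> q x" if "(anti a1 b1 \<noteq> anti a3 b3) \<noteq> (anti a2 b2 \<noteq> anti a3 b3)"
      proof -
        have "anti a1 b1 \<noteq> anti a2 b2" using that by blast
        from separate[OF this] c show ?thesis by (fastforce simp: p_def q_def e_def)
      qed
    qed
    then obtain k l where kl: "k \<in> H" "l \<in> H"
      and pq: "p (k, l) = (anti a1 b1 \<noteq> anti a3 b3)" "q (k, l) = (anti a2 b2 \<noteq> anti a3 b3)"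
      by auto
    \<comment> \<open>Whether the factor \<open>(z, z, z)\<close> is needed.\<close>
    define b where "b \<longleftrightarrow> anti a3 b3 \<noteq> e a3 b3 k l"
    have b: "anti a1 b1 = ((b \<noteq> anti k a1) \<noteq> anti l b1)"
      "anti a2 b2 = ((b \<noteq> anti k a2) \<noteq> anti l b2)"
      "anti a3 b3 = ((b \<noteq> anti k a3) \<noteq> anti l b3)"
      using pq by (auto simp: p_def q_def e_def b_def)
    let ?s = "(sign (b \<noteq> anti k a1), sign (b \<noteq> anti k a2), sign (b \<noteq> anti k a3))"
    let ?t = "(sign (anti l b1), sign (anti l b2), sign (anti l b3))"
    let ?d = "\<lambda>x. (x, x, x)"
    have d: "?d x \<in> diag3 H" if "x \<in> H" for x using that by (auto simp: diag3_def)
    have s: "?s \<otimes>\<^bsub>?\<Gamma>\<^esub> u = ?d (sign b \<otimes> k) \<otimes>\<^bsub>?\<Gamma>\<^esub> u \<otimes>\<^bsub>?\<Gamma>\<^esub> ?d (inv k)"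
      using c kl Hc by (simp add: uv flip: conj_sign)
    have t: "?t \<otimes>\<^bsub>?\<Gamma>\<^esub> v = ?d l \<otimes>\<^bsub>?\<Gamma>\<^esub> v \<otimes>\<^bsub>?\<Gamma>\<^esub> ?d (inv l)"
      using c kl Hc conj_sign[of _ l False] by (simp add: uv sign_def[of False])
    have st: "u \<otimes>\<^bsub>?\<Gamma>\<^esub> v = ?s \<otimes>\<^bsub>?\<Gamma>\<^esub> ?t \<otimes>\<^bsub>?\<Gamma>\<^esub> (v \<otimes>\<^bsub>?\<Gamma>\<^esub> u)"
      using c swap_sign[of a1 b1] swap_sign[of a2 b2] swap_sign[of a3 b3]
      unfolding b by (simp add: uv sign_mult)
    show "\<exists>s\<in>Z. \<exists>t\<in>Z.
        (\<exists>k1\<in>diag3 H. \<exists>k2\<in>diag3 H. s \<otimes>\<^bsub>?\<Gamma>\<^esub> u = k1 \<otimes>\<^bsub>?\<Gamma>\<^esub> u \<otimes>\<^bsub>?\<Gamma>\<^esub> k2) \<and>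
        (\<exists>k1\<in>diag3 H. \<exists>k2\<in>diag3 H. t \<otimes>\<^bsub>?\<Gamma>\<^esub> v = k1 \<otimes>\<^bsub>?\<Gamma>\<^esub> v \<otimes>\<^bsub>?\<Gamma>\<^esub> k2) \<and>
        u \<otimes>\<^bsub>?\<Gamma>\<^esub> v = s \<otimes>\<^bsub>?\<Gamma>\<^esub> t \<otimes>\<^bsub>?\<Gamma>\<^esub> (v \<otimes>\<^bsub>?\<Gamma>\<^esub> u)"
    proof (intro bexI conjI)
      show "?s \<otimes>\<^bsub>?\<Gamma>\<^esub> u = ?d (sign b \<otimes> k) \<otimes>\<^bsub>?\<Gamma>\<^esub> u \<otimes>\<^bsub>?\<Gamma>\<^esub> ?d (inv k)" by (rule s)
      show "?t \<otimes>\<^bsub>?\<Gamma>\<^esub> v = ?d l \<otimes>\<^bsub>?\<Gamma>\<^esub> v \<otimes>\<^bsub>?\<Gamma>\<^esub> ?d (inv l)" by (rule t)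
    qed (use st d kl H_closed signH ZI in auto)
  qed
qed

theorem gelfand_diag3_iff_centralizer_central:
  assumes "finite (carrier G)" "subgroup H G" "z \<in> H"
  shows "gelfand_pair (G \<times>\<times> G \<times>\<times> G\<lparr>carrier := H\<rparr>) (diag3 H) \<longleftrightarrow>
    (\<forall>w\<in>carrier G. (\<forall>h\<in>H. h \<otimes> w = w \<otimes> h) \<longrightarrow> (\<forall>g\<in>carrier G. g \<otimes> w = w \<otimes> g))"
  using gelfand_diag3_if_centralizer_central[OF assms]
    gelfand_diag3_imp_centralizer_central[OF group_axioms assms(1,2)] by blast

end

section \<open>Commutation in Clifford groups\<close>

text \<open>The pairs in \<open>A \<times> B\<close> split into those with \<open>a > b\<close>, those with \<open>a < b\<close> and the diagonal.\<close>

lemma inversions_swap: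
  assumes "finite A" "finite B"
  shows "inversions A B + inversions B A + card (A \<inter> B) = card A * card B"
proof -
  have fin: "finite {(a, b) \<in> A \<times> B. P a b}" for P
    using assms by (auto intro: finite_subset[OF _ finite_cartesian_product])
  have "inversions B A = card {(a, b) \<in> A \<times> B. a < b}"
    unfolding inversions_def by (rule bij_betw_same_card[of prod.swap]) (force simp: bij_betw_def inj_on_def)
  moreover have "card (A \<inter> B) = card {(a, b) \<in> A \<times> B. a = b}"
    by (rule bij_betw_same_card[of "\<lambda>a. (a, a)"]) (auto simp: bij_betw_def inj_on_def)
  moreover have "card (A \<times> B) = card ({(a, b) \<in> A \<times> B. a > b} \<union> {(a, b) \<in> A \<times> B. a < b}
      \<union> {(a, b) \<in> A \<times> B. a = b})"
    by (rule arg_cong[where f = card]) auto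
  moreover have "\<dots> = inversions A B + card {(a, b) \<in> A \<times> B. a < b} + card {(a, b) \<in> A \<times> B. a = b}"
    unfolding inversions_def using fin by (subst card_Un_disjoint | fastforce)+
  ultimately show ?thesis by (simp add: card_cartesian_product)
qed

lemma clifford_commute_iff:
  assumes "x \<in> carrier (clifford_group n)" "y \<in> carrier (clifford_group n)"
  shows "x \<otimes>\<^bsub>clifford_group n\<^esub> y = y \<otimes>\<^bsub>clifford_group n\<^esub> x \<longleftrightarrow>
    even (card (snd x) * card (snd y) + card (snd x \<inter> snd y))"
proof -
  obtain e A f B where xy: "x = (e, A)" "y = (f, B)" by fastforce
  have fin: "finite A" "finite B" and ef: "e \<in> {1, -1}" "f \<in> {1, -1}"
    using assms by (auto simp: xy clifford_group_def intro: finite_subset)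
  have "x \<otimes>\<^bsub>clifford_group n\<^esub> y = y \<otimes>\<^bsub>clifford_group n\<^esub> x \<longleftrightarrow>
      (-1 :: int) ^ inversions A B = (-1) ^ inversions B A"
    using ef by (auto simp: xy clifford_group_def)
  also have "\<dots> \<longleftrightarrow> even (inversions A B + inversions B A)"
    by (auto simp: minus_one_power_iff)
  also have "\<dots> \<longleftrightarrow> even (card A * card B + card (A \<inter> B))"
    unfolding inversions_swap[OF fin, symmetric] by auto
  finally show ?thesis by (simp add: xy)
qed

lemma clifford_sign_commutator_group: "sign_commutator_group (clifford_group n) (-1, {})"
proof (intro sign_commutator_group.intro clifford_group_is_group sign_commutator_group_axioms.intro)
  fix x y assume "x \<in> carrier (clifford_group n)" "y \<in> carrier (clifford_group n)"
  then show "x \<otimes>\<^bsub>clifford_group n\<^esub> y = y \<otimes>\<^bsub>clifford_group n\<^esub> x \<or>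
      x \<otimes>\<^bsub>clifford_group n\<^esub> y = (-1, {}) \<otimes>\<^bsub>clifford_group n\<^esub> (y \<otimes>\<^bsub>clifford_group n\<^esub> x)"
    by (cases "even (inversions (snd x) (snd y))"; cases "even (inversions (snd y) (snd x))")
       (auto simp: clifford_group_def inversions_def)
qed (auto simp: clifford_group_def inversions_def)

text \<open>Signs do not affect commutation, so the condition on centralizers becomes one on subsets.\<close>

lemma clifford_gelfand_iff:
  assumes "m \<le> n"
  shows "gelfand_pair (clifford_group n \<times>\<times> clifford_group n \<times>\<times> clifford_group m)
      (diag3 (carrier (clifford_group m))) \<longleftrightarrow>
    (\<forall>A\<subseteq>{1..n}. (\<forall>B\<subseteq>{1..m}. even (card A * card B + card (A \<inter> B))) \<longrightarrow>
      (\<forall>B\<subseteq>{1..n}. even (card A * card B + card (A \<inter> B))))"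
    (is "?gel \<longleftrightarrow> ?sets")
proof -
  let ?G = "clifford_group n" and ?H = "carrier (clifford_group m)"
  interpret sign_commutator_group ?G "(-1, {})" by (rule clifford_sign_commutator_group)
  have sub: "subgroup ?H ?G" by (rule clifford_group_subgroup[OF assms])
  have G: "carrier ?G = {1, -1} \<times> Pow {1..n}" and H: "?H = {1, -1} \<times> Pow {1..m}"
    by (simp_all add: clifford_group_def)
  have res: "?G\<lparr>carrier := ?H\<rparr> = clifford_group m"
    unfolding H by (rule clifford_group_restrict)
  have "?gel \<longleftrightarrow> (\<forall>w\<in>carrier ?G. (\<forall>h\<in>?H. h \<otimes>\<^bsub>?G\<^esub> w = w \<otimes>\<^bsub>?G\<^esub> h) \<longrightarrow>
      (\<forall>g\<in>carrier ?G. g \<otimes>\<^bsub>?G\<^esub> w = w \<otimes>\<^bsub>?G\<^esub> g))"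
    by (rule gelfand_diag3_iff_centralizer_central[OF _ sub, unfolded res]) (simp_all add: G H)
  also have "\<dots> \<longleftrightarrow> (\<forall>w\<in>carrier ?G.
      (\<forall>h\<in>?H. even (card (snd w) * card (snd h) + card (snd w \<inter> snd h))) \<longrightarrow>
      (\<forall>g\<in>carrier ?G. even (card (snd w) * card (snd g) + card (snd w \<inter> snd g))))"
  proof -
    have "g \<otimes>\<^bsub>?G\<^esub> w = w \<otimes>\<^bsub>?G\<^esub> g \<longleftrightarrow> even (card (snd w) * card (snd g) + card (snd w \<inter> snd g))"
      if "w \<in> carrier ?G" "g \<in> carrier ?G" for w g
      using clifford_commute_iff[OF that] by metis
    moreover have "h \<in> carrier ?G" if "h \<in> ?H" for h
      using that sub subgroup.mem_carrier by metis
    ultimately show ?thesis by (metis (no_types, lifting))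
  qed
  also have "\<dots> \<longleftrightarrow> ?sets" by (simp add: G H Ball_def[of "Pow S" for S] ex_disj_distrib)
  finally show ?thesis .
qed

theorem theorem1p2:
  fixes n :: nat
  assumes "n \<ge> 1"
  shows "gelfand_pair (clifford_group n \<times>\<times> clifford_group n \<times>\<times> clifford_group n)
           (diag3 (carrier (clifford_group n)))
    \<and> (gelfand_pair (clifford_group n \<times>\<times> clifford_group n \<times>\<times> clifford_group (n - 1))
           (diag3 (carrier (clifford_group (n - 1))))
         \<longleftrightarrow> odd n)"
proof (intro conjI iffI)
  show "gelfand_pair (clifford_group n \<times>\<times> clifford_group n \<times>\<times> clifford_group n)
      (diag3 (carrier (clifford_group n)))"
    by (simp add: clifford_gelfand_iff)
next
  assume "gelfand_pair (clifford_group n \<times>\<times> clifford_group n \<times>\<times> clifford_group (n - 1))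
    (diag3 (carrier (clifford_group (n - 1))))"
  then have centralizer_central:
    "\<forall>A\<subseteq>{1..n}. (\<forall>B\<subseteq>{1..n - 1}. even (card A * card B + card (A \<inter> B))) \<longrightarrow>
      (\<forall>B\<subseteq>{1..n}. even (card A * card B + card (A \<inter> B)))"
    by (simp add: clifford_gelfand_iff)
  show "odd n"
  proof
    assume "even n"
    \<comment> \<open>\<open>{1..n - 1}\<close> has odd size, so it commutes with its subsets but not with \<open>{n}\<close>.\<close>
    have "even (card {1..n - 1} * card B + card ({1..n - 1} \<inter> B))" if "B \<subseteq> {1..n - 1}" for B
    proof -
      have "{1..n - 1} \<inter> B = B" using that by blast
      then show ?thesis using \<open>even n\<close> assms by simp
    qed
    then have "even (card {1..n - 1} * card {n} + card ({1..n - 1} \<inter> {n}))"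
      using centralizer_central[rule_format, of "{1..n - 1}" "{n}"] assms by auto
    then show False using \<open>even n\<close> assms by simp
  qed
next
  assume "odd n"
  have "even (card A * card B + card (A \<inter> B))"
    if A: "A \<subseteq> {1..n}" and B: "B \<subseteq> {1..n}"
      and centralizes: "\<forall>B\<subseteq>{1..n - 1}. even (card A * card B + card (A \<inter> B))" for A B
  proof (cases "n \<in> B")
    case False
    have "B \<subseteq> {1..n} - {n}" using B False by blast
    then have "B \<subseteq> {1..n - 1}" by auto
    then show ?thesis using centralizes by blast
  next
    case True
    \<comment> \<open>The parities for \<open>B\<close> and its complement add up to that of \<open>|A| n + |A|\<close>, which is even.\<close>
    let ?B' = "{1..n} - B"
    have "?B' \<subseteq> {1..n} - {n}" using True by blast
    then have "?B' \<subseteq> {1..n - 1}" by auto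
    then have "even (card A * card ?B' + card (A \<inter> ?B'))" using centralizes by blast
    moreover have "card B + card ?B' = n"
      using card_Diff_subset[OF finite_subset[OF B] B] card_mono[OF _ B] by simp
    moreover have "card (A \<inter> B) + card (A \<inter> ?B') = card A"
    proof -
      have "finite A" using A finite_subset by blast
      then have "card (A \<inter> B) + card (A - B) = card A" by (simp add: card_Diff_subset_Int card_mono)
      moreover have "A \<inter> ?B' = A - B" using A by blast
      ultimately show ?thesis by simp
    qed
    ultimately show ?thesis using \<open>odd n\<close>
      by (metis even_add even_mult_iff distrib_left)
  qed
  then show "gelfand_pair (clifford_group n \<times>\<times> clifford_group n \<times>\<times> clifford_group (n - 1))
      (diag3 (carrier (clifford_group (n - 1))))"
    by (simp add: clifford_gelfand_iff)
qed

end
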